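(* For every positive integer $k$, $$\lim_{N \to \infty}\frac{\#\{0 \le n \le N : p(n,k) \text{ is odd}\}}{N} \ge \frac{2}{k(k+1)}.$$
   Context: For a nonnegative integer $n$ and a positive integer $k$, $p(n,k)$ denotes the number of partitions of $n$ into parts each less than or equal to $k$ (so $p(0,k)=1$); equivalently, $\sum_{n\ge 0} p(n,k)q^n = \prod_{i=1}^{k} \frac{1}{1-q^i}$. *)

theory Defs
  imports Complex_Main "HOL-Library.Multiset"
begin

definition partitions_le :: "nat \<Rightarrow> nat \<Rightarrow> nat multiset set" where
  "partitions_le n k = {M. sum_mset M = n \<and> set_mset M \<subseteq> {1..k}}"

definition p :: "nat \<Rightarrow> nat \<Rightarrow> nat" where
  "p n k = card (partitions_le n k)"

lemma finite_partitions_le: "finite (partitions_le n k)"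
proof -
  have size_le: "size M \<le> sum_mset M" if "set_mset M \<subseteq> {1..k}" for M :: "nat multiset"
    using that
  proof (induction M)
    case (add x M)
    then have "1 \<le> x" "size M \<le> sum_mset M"
      by simp_all
    then show ?case
      by simp
  qed simp
  have "partitions_le n k \<subseteq> mset ` {xs. set xs \<subseteq> {1..k} \<and> length xs \<le> n}"
  proof
    fix M assume M: "M \<in> partitions_le n k"
    obtain xs where xs: "M = mset xs"
      by (metis ex_mset)
    have "set xs \<subseteq> {1..k}" "length xs \<le> n"
      using M size_le[of M] by (simp_all add: partitions_le_def xs)
    then show "M \<in> mset ` {xs. set xs \<subseteq> {1..k} \<and> length xs \<le> n}"
      using xs by blast
  qed
  moreover have "finite {xs. set xs \<subseteq> {1..k} \<and> length xs \<le> n}"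
    by (rule finite_lists_length_le) simp
  ultimately show ?thesis
    by (blast intro: finite_subset)
qed

lemma p_0: "p 0 k = 1"
proof -
  have "partitions_le 0 k = {{#}}"
  proof (intro equalityI subsetI)
    fix M assume "M \<in> partitions_le 0 k"
    then have "x \<notin># M" for x
      by (auto simp: partitions_le_def)
    then show "M \<in> {{#}}"
      by (simp add: multiset_eq_iff not_in_iff)
  qed (simp add: partitions_le_def)
  then show ?thesis
    by (simp add: p_def)
qed

end

theory Submission
  imports Defs
begin

text \<open>
  Fix a modulus \<open>m \<noteq> 1\<close>. By the recurrence \<open>p (n + k) k = p (n + k) (k - 1) + p n k\<close>, moving \<open>n\<close> by
  \<open>m * T * k\<close>, where \<open>T\<close> is a period of \<open>p _ (k - 1)\<close> modulo \<open>m\<close>, adds to \<open>p n k\<close> the same \<open>T\<close>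
  residues \<open>m\<close> times over, that is \<open>0\<close>. So \<open>p _ k\<close> is periodic modulo \<open>m\<close>, and the density exists.
  Read backwards, the recurrence shows that if \<open>m\<close> divides \<open>k(k+1)/2\<close> consecutive values of \<open>p _ k\<close>,
  then it divides \<open>(k-1)k/2\<close> consecutive values of \<open>p _ (k - 1)\<close>, and so on down to a value of
  \<open>p _ 1\<close>, which is constantly \<open>1\<close>. Hence every interval of length \<open>k(k+1)/2\<close> contains some \<open>n\<close>
  with \<open>p n k\<close> not divisible by \<open>m\<close>. The theorem is the case \<open>m = 2\<close>.
\<close>

definition periodic :: "nat \<Rightarrow> (nat \<Rightarrow> 'a) \<Rightarrow> bool" where
  "periodic T f \<longleftrightarrow> (\<forall>n. f (n + T) = f n)"

definition syndetic :: "nat \<Rightarrow> nat set \<Rightarrow> bool" where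
  "syndetic D A \<longleftrightarrow> (\<forall>m. \<exists>n\<in>{m..<m + D}. n \<in> A)"

definition has_density :: "nat set \<Rightarrow> real \<Rightarrow> bool" where
  "has_density A d \<longleftrightarrow> (\<lambda>N. real (card {n. n \<le> N \<and> n \<in> A}) / real N) \<longlonglongrightarrow> d"

lemma periodic_add_mult:
  assumes "periodic T f"
  shows "f (n + j * T) = f n"
proof (induction j)
  case (Suc j)
  have "f (n + Suc j * T) = f (n + j * T + T)"
    by (simp add: algebra_simps)
  then show ?case
    using assms Suc.IH by (simp add: periodic_def)
qed simp

lemma periodic_comp: "periodic T f \<Longrightarrow> periodic T (\<lambda>n. g (f n))"
  by (simp add: periodic_def)

lemma finite_range_periodic:
  assumes "periodic T f" "T > 0"
  shows "finite (range f)"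
proof (rule finite_surj)
  show "range f \<subseteq> f ` {..<T}"
  proof
    fix y assume "y \<in> range f"
    then obtain n where "y = f n"
      by blast
    also have "\<dots> = f (n mod T)"
      using periodic_add_mult[OF assms(1), of "n mod T" "n div T"] by simp
    finally show "y \<in> f ` {..<T}"
      using assms(2) by simp
  qed
qed simp

lemma sum_lessThan_add_period:
  fixes f :: "nat \<Rightarrow> 'a::comm_monoid_add"
  assumes "periodic T f"
  shows "(\<Sum>n<N + T. f n) = (\<Sum>n<N. f n) + (\<Sum>n<T. f n)"
  using assms by (induction N) (simp_all add: periodic_def ac_simps)

lemma sum_lessThan_mult_period:
  fixes f :: "nat \<Rightarrow> 'a::semiring_1"
  assumes "periodic T f"
  shows "(\<Sum>n<m * T. f n) = of_nat m * (\<Sum>n<T. f n)"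
proof (induction m)
  case (Suc m)
  then show ?case
    using sum_lessThan_add_period[OF assms, of "m * T"] by (simp add: algebra_simps)
qed simp

lemma periodic_mean:
  fixes f :: "nat \<Rightarrow> 'a::real_normed_vector"
  assumes f: "periodic T f" and T: "T > 0"
  shows "(\<lambda>N. (\<Sum>n<N. f n) /\<^sub>R real N) \<longlonglongrightarrow> (\<Sum>n<T. f n) /\<^sub>R real T"
proof -
  define \<mu> where "\<mu> = (\<Sum>n<T. f n) /\<^sub>R real T"
  define S where "S N = (\<Sum>n<N. f n - \<mu>)" for N
  have "S T = 0"
    using T by (simp add: S_def \<mu>_def sum_subtractf sum_constant_scaleR)
  then have "periodic T S"
    using sum_lessThan_add_period[OF periodic_comp[OF f, of "\<lambda>x. x - \<mu>"]]
    by (simp add: periodic_def S_def)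
  then have "finite (range (\<lambda>N. norm (S N)))"
    using T by (rule finite_range_periodic[OF periodic_comp])
  then obtain K where K: "norm (S N) \<le> K" for N
    by (metis Max_ge rangeI)
  have "(\<lambda>N. S N /\<^sub>R real N) \<longlonglongrightarrow> 0"
  proof (rule tendsto_0_le[OF lim_1_over_n])
    show "\<forall>\<^sub>F N in sequentially. norm (S N /\<^sub>R real N) \<le> norm (1 / real N) * K"
      using K by (intro always_eventually) (simp add: divide_simps)
  qed
  then have "(\<lambda>N. \<mu> + S N /\<^sub>R real N) \<longlonglongrightarrow> \<mu> + 0"
    by (intro tendsto_add tendsto_const)
  moreover have "\<forall>\<^sub>F N in sequentially. \<mu> + S N /\<^sub>R real N = (\<Sum>n<N. f n) /\<^sub>R real N"
    using eventually_gt_at_top[of 0]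
    by eventually_elim (simp add: S_def sum_subtractf scaleR_diff_right sum_constant_scaleR)
  ultimately show ?thesis
    by (simp add: tendsto_cong \<mu>_def)
qed

lemma periodic_has_density:
  assumes "periodic T (\<lambda>n. n \<in> A)" "T > 0"
  shows "has_density A (real (card {n. n < T \<and> n \<in> A}) / real T)"
proof -
  define c where "c N = real (card {n. n < N \<and> n \<in> A})" for N
  have c_sum: "(\<Sum>n<N. of_bool (n \<in> A)) = c N" for N
    by (simp add: c_def Int_def)
  have "(\<lambda>N. c N / real N) \<longlonglongrightarrow> c T / real T"
    using periodic_mean[OF periodic_comp[OF assms(1), of "of_bool :: bool \<Rightarrow> real"] assms(2)]
    by (simp add: c_sum divide_inverse_commute)
  then have "(\<lambda>N. c (Suc N) / real (Suc N) * (real (Suc N) / real N)) \<longlonglongrightarrow> c T / real T * 1"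
    by (intro tendsto_mult LIMSEQ_Suc LIMSEQ_Suc_n_over_n)
  then show ?thesis
    by (simp add: has_density_def c_def less_Suc_eq_le)
qed

lemma syndetic_card_ge:
  assumes "syndetic D A"
  shows "q \<le> card {n. n < q * D \<and> n \<in> A}"
proof (induction q)
  case (Suc q)
  obtain n where n: "n \<in> {q * D..<q * D + D}" "n \<in> A"
    using assms unfolding syndetic_def by blast
  have "Suc q \<le> card (insert n {n. n < q * D \<and> n \<in> A})"
    using n Suc.IH by (subst card_insert_disjoint) auto
  also have "\<dots> \<le> card {n. n < Suc q * D \<and> n \<in> A}"
    using n by (intro card_mono) auto
  finally show ?case .
qed simp

lemma syndetic_density_ge:
  assumes A: "syndetic D A" and d: "has_density A d"
  shows "1 / real D \<le> d"
proof (rule LIMSEQ_le_const)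
  have "D > 0"
    using A by (auto simp: syndetic_def intro: gr0I)
  then have "strict_mono (\<lambda>q. q * D)"
    by (simp add: strict_mono_def)
  then show "(\<lambda>q. real (card {n. n \<le> q * D \<and> n \<in> A}) / real (q * D)) \<longlonglongrightarrow> d"
    using LIMSEQ_subseq_LIMSEQ[OF d[unfolded has_density_def]] by (fastforce simp: o_def)
  have "1 / real D \<le> real (card {n. n \<le> q * D \<and> n \<in> A}) / real (q * D)" if "q \<ge> 1" for q
  proof -
    have "q \<le> card {n. n < q * D \<and> n \<in> A}"
      by (rule syndetic_card_ge[OF A])
    also have "\<dots> \<le> card {n. n \<le> q * D \<and> n \<in> A}"
      by (intro card_mono) auto
    finally show ?thesis
      using that \<open>D > 0\<close> by (simp add: field_simps)
  qed
  then show "\<exists>M. \<forall>q\<ge>M. 1 / real D \<le> real (card {n. n \<le> q * D \<and> n \<in> A}) / real (q * D)"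
    by blast
qed

lemma periodic_mod_of_difference:
  fixes a b :: "nat \<Rightarrow> nat"
  assumes b: "\<And>n. b (n + k) = a (n + k) + b n"
    and a: "periodic T (\<lambda>n. a n mod m)"
  shows "periodic (m * T * k) (\<lambda>n. b n mod m)"
  unfolding periodic_def
proof
  fix n
  define f where "f i = a (n + Suc i * k)" for i
  have telescope: "b (n + j * k) = b n + (\<Sum>i<j. f i)" for j
  proof (induction j)
    case (Suc j)
    then show ?case
      using b[of "n + j * k"] by (simp add: f_def algebra_simps)
  qed simp
  have "periodic T (\<lambda>i. f i mod m)"
    unfolding periodic_def f_def
    using periodic_add_mult[OF a, of "n + Suc _ * k" k] by (simp add: algebra_simps)
  then have "(\<Sum>i<m * T. f i mod m) mod m = 0"
    by (simp add: sum_lessThan_mult_period)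
  then have "(\<Sum>i<m * T. f i) mod m = 0"
    by (simp add: mod_sum_eq)
  then show "b (n + m * T * k) mod m = b n mod m"
    unfolding telescope by (metis add.right_neutral mod_add_right_eq)
qed

lemma syndetic_not_dvd_of_difference:
  fixes a b :: "nat \<Rightarrow> 'a::comm_semiring_1_cancel"
  assumes b: "\<And>n. b (n + k) = a (n + k) + b n"
    and a: "syndetic D {n. \<not> m dvd a n}"
  shows "syndetic (D + k) {n. \<not> m dvd b n}"
  unfolding syndetic_def
proof
  fix l
  obtain n where "n \<in> {l + k..<l + k + D}" and n: "\<not> m dvd a n"
    using a unfolding syndetic_def by blast
  then obtain n' where n': "n = n' + k" "l \<le> n'" "n' + k < l + (D + k)"
    by (auto simp: le_iff_add ac_simps)
  have "\<not> m dvd b n \<or> \<not> m dvd b n'"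
    using n b[of n'] by (auto simp: n'(1) dvd_add_left_iff)
  moreover have "n \<in> {l..<l + (D + k)}" "n' \<in> {l..<l + (D + k)}"
    using n' by auto
  ultimately show "\<exists>n\<in>{l..<l + (D + k)}. n \<in> {n. \<not> m dvd b n}"
    by blast
qed

lemma partitions_le_add_Suc:
  "partitions_le (n + Suc k) (Suc k) =
    partitions_le (n + Suc k) k \<union> add_mset (Suc k) ` partitions_le n (Suc k)"
proof (intro equalityI subsetI)
  fix M assume M: "M \<in> partitions_le (n + Suc k) (Suc k)"
  show "M \<in> partitions_le (n + Suc k) k \<union> add_mset (Suc k) ` partitions_le n (Suc k)"
  proof (cases "Suc k \<in># M")
    case True
    then obtain M' where "M = add_mset (Suc k) M'"
      by (blast dest: multi_member_split)
    then show ?thesis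
      using M by (auto simp: partitions_le_def)
  next
    case False
    then show ?thesis
      using M by (force simp: partitions_le_def le_Suc_eq)
  qed
qed (force simp: partitions_le_def)

lemma p_add_Suc: "p (n + Suc k) (Suc k) = p (n + Suc k) k + p n (Suc k)"
proof -
  have "partitions_le (n + Suc k) k \<inter> add_mset (Suc k) ` partitions_le n (Suc k) = {}"
    by (auto simp: partitions_le_def)
  then show ?thesis
    by (simp add: p_def partitions_le_add_Suc card_Un_disjoint finite_partitions_le
        card_image inj_on_def del: add_Suc_right)
qed

lemma p_Suc_0: "p (Suc n) 0 = 0"
  by (auto simp: p_def partitions_le_def card_eq_0_iff)

lemma p_1_right: "p n (Suc 0) = 1"
proof (induction n)
  case (Suc n)
  then show ?case
    using p_add_Suc[of n 0] by (simp add: p_Suc_0)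
qed (simp add: p_0)

lemma p_mod_periodic: "periodic (m ^ k * fact (Suc k)) (\<lambda>n. p n (Suc k) mod m)"
proof (induction k)
  case 0
  then show ?case
    by (simp add: periodic_def p_1_right)
next
  case (Suc k)
  have "periodic (m * (m ^ k * fact (Suc k)) * Suc (Suc k)) (\<lambda>n. p n (Suc (Suc k)) mod m)"
    by (rule periodic_mod_of_difference[OF p_add_Suc Suc.IH])
  then show ?case
    by (simp only: power_Suc fact_Suc of_nat_id ac_simps)
qed

lemma syndetic_not_dvd_p:
  assumes "m \<noteq> 1"
  shows "syndetic (\<Sum>{1..Suc k}) {n. \<not> m dvd p n (Suc k)}"
proof (induction k)
  case 0
  then show ?case
    using assms by (simp add: syndetic_def p_1_right)
next
  case (Suc k)
  have "syndetic (\<Sum>{1..Suc k} + Suc (Suc k)) {n. \<not> m dvd p n (Suc (Suc k))}"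
    by (rule syndetic_not_dvd_of_difference[OF p_add_Suc Suc.IH])
  then show ?case
    by simp
qed

theorem theorem1p3:
  fixes k :: nat
  assumes "k \<ge> 1"
  shows "\<exists>L::real.
    (\<lambda>N::nat. real (card {n::nat. 0 \<le> n \<and> n \<le> N \<and> odd (p n k)}) / real N) \<longlonglongrightarrow> L \<and>
    L \<ge> 2 / (real k * (real k + 1))"
proof -
  obtain j where k: "k = Suc j"
    using assms by (cases k) auto
  let ?odd = "{n. odd (p n k)}"
  have "periodic (2 ^ j * fact k) (\<lambda>n. n \<in> ?odd)"
    using periodic_comp[OF p_mod_periodic[of 2 j], of "\<lambda>r. r \<noteq> 0"] by (simp add: k dvd_eq_mod_eq_0)
  then obtain L where L: "has_density ?odd L"
    using periodic_has_density[of "2 ^ j * fact k" ?odd] by auto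
  have odd_syndetic: "syndetic (\<Sum>{1..k}) ?odd"
    unfolding k by (rule syndetic_not_dvd_p) simp
  have "2 / (real k * (real k + 1)) = 1 / real (\<Sum>{1..k})"
    by (simp flip: double_gauss_sum_from_Suc_0)
  also have "\<dots> \<le> L"
    using odd_syndetic L by (rule syndetic_density_ge)
  finally show ?thesis
    using L by (auto simp: has_density_def)
qed

end
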